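(* Let $p>0$ and let $A=(a_{n,k})_{n,k\ge 0}$ be an infinite matrix of nonnegative real numbers such that $\sum_{k=0}^{\infty}a_{n,k}=1$ for every $n=0,1,2,\dots$ and $\lim_{n\to\infty}a_{n,0}=0$. Suppose that the rows $(a_{n,k})_{k=0}^{\infty}$ belong to $GM({}_5\beta)$ uniformly in $n$, i.e. there exist constants $c>1$ and $K>0$ such that for all $n$ and all integers $m\ge 1$ $$\sum_{k=m}^{2m-1}|a_{n,k}-a_{n,k+1}|\le K\sum_{k=\max(1,[m/c])}^{[cm]}\frac{a_{n,k}}{k}.$$ Then there is a constant $C>0$, depending only on $p$, $c$ and $K$, such that for every $f\in C_{2\pi}$ and every $n$ $$\left\Vert T_{n,A}^{p}f\right\Vert\le C\sum_{k=0}^{\infty}a_{n,k}\,\bigl(E_{[k/2^{[c]}]}(f)\bigr)^{p}.$$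
   Context: $C_{2\pi}$ is the class of $2\pi$-periodic continuous real-valued functions, with the norm $\Vert g\Vert=\sup_{t\in[-\pi,\pi]}|g(t)|$. $S_kf$ denotes the $k$-th partial sum of the trigonometric Fourier series of $f$. $T_{n,A}^{p}f(x)=\sum_{k=0}^{\infty}a_{n,k}|S_kf(x)-f(x)|^{p}$. $E_k(f)=\inf_{t_k}\Vert f-t_k\Vert$, the infimum being over trigonometric polynomials $t_k$ of order at most $k$. $[x]$ denotes the integer part of $x$. *)

theory Defs
  imports "HOL-Analysis.Analysis"
begin

definition C2pi :: "(real \<Rightarrow> real) set" where
  "C2pi = {f. continuous_on UNIV f \<and> (\<forall>x. f (x + 2 * pi) = f x)}"

definition sup_norm :: "(real \<Rightarrow> real) \<Rightarrow> real" where
  "sup_norm g = (SUP t\<in>{-pi..pi}. \<bar>g t\<bar>)"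

definition fourier_cos :: "(real \<Rightarrow> real) \<Rightarrow> nat \<Rightarrow> real" where
  "fourier_cos f j = (1 / pi) * integral {-pi..pi} (\<lambda>t. f t * cos (real j * t))"

definition fourier_sin :: "(real \<Rightarrow> real) \<Rightarrow> nat \<Rightarrow> real" where
  "fourier_sin f j = (1 / pi) * integral {-pi..pi} (\<lambda>t. f t * sin (real j * t))"

definition fourier_partial_sum :: "nat \<Rightarrow> (real \<Rightarrow> real) \<Rightarrow> real \<Rightarrow> real" where
  "fourier_partial_sum k f x =
     fourier_cos f 0 / 2
     + (\<Sum>j=1..k. fourier_cos f j * cos (real j * x) + fourier_sin f j * sin (real j * x))"

definition trig_polys :: "nat \<Rightarrow> (real \<Rightarrow> real) set" where
  "trig_polys k =
     {t. \<exists>u v :: nat \<Rightarrow> real. t = (\<lambda>x. \<Sum>j\<le>k. u j * cos (real j * x) + v j * sin (real j * x))}"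

definition best_approx :: "nat \<Rightarrow> (real \<Rightarrow> real) \<Rightarrow> real" where
  "best_approx k f = (INF t\<in>trig_polys k. sup_norm (\<lambda>x. f x - t x))"

text \<open>The strong mean generated by one row \<open>a\<close> of the matrix. It takes values in
  \<^typ>\<open>ennreal\<close>, so a divergent series has the value infinity, and a finite upper bound on its
  supremum includes convergence of the series at every point.\<close>

definition strong_mean :: "(nat \<Rightarrow> real) \<Rightarrow> real \<Rightarrow> (real \<Rightarrow> real) \<Rightarrow> real \<Rightarrow> ennreal" where
  "strong_mean a p f x = (\<Sum>k. ennreal (a k * \<bar>fourier_partial_sum k f x - f x\<bar> powr p))"

definition ennreal_sup_norm :: "(real \<Rightarrow> ennreal) \<Rightarrow> ennreal" where
  "ennreal_sup_norm g = (SUP t\<in>{-pi..pi}. g t)"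

definition GM5 :: "real \<Rightarrow> real \<Rightarrow> (nat \<Rightarrow> real) \<Rightarrow> bool" where
  "GM5 c K a \<longleftrightarrow>
     (\<forall>m\<ge>1. (\<Sum>k=m..2*m-1. \<bar>a k - a (k+1)\<bar>)
        \<le> K * (\<Sum>k=max 1 (nat \<lfloor>real m / c\<rfloor>)..nat \<lfloor>c * real m\<rfloor>. a k / real k))"

end

theory Submission
  imports Defs
begin

text \<open>The heart of the matter is a bound for sums of Dirichlet kernels with arbitrary signs over an
  arbitrary set \<open>B \<subseteq> {..<N}\<close> of \<open>b\<close> indices: the \<open>L\<^sup>1\<close> norm is at most a constant times
  \<open>b (1 + ln (N/b))\<close>. By duality the average of \<open>\<bar>S\<^sub>k g x - g x\<bar>\<close> over any \<open>b\<close> indices is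
  \<open>O((N/b) powr \<epsilon>)\<close> times the norm of \<open>g\<close>, for every \<open>\<epsilon> > 0\<close>, so the \<open>r\<close>-th largest of
  these deviations is \<open>O((N/r) powr \<epsilon>)\<close>, and the choice \<open>\<epsilon> = 1/(2p)\<close> makes the sum of their \<open>p\<close>-th
  powers \<open>O(N)\<close>. Since \<open>S\<^sub>k\<close> reproduces trigonometric polynomials of order \<open>m \<le> k\<close>, the sum of
  \<open>\<bar>S\<^sub>k f x - f x\<bar> powr p\<close> over \<open>m \<le> k < N\<close> is \<open>O(N (E\<^sub>m f) powr p)\<close>.

  On a dyadic block \<open>m \<le> k < 2m\<close> every \<open>a\<^sub>k\<close> is at most the mean of \<open>a\<close> over the block plus its
  variation there, which the GM5 condition controls by nearby values of \<open>a\<close>. In the sum over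
  the blocks \<open>m = 2\<^sup>j\<close>, an index \<open>k\<close> is met only when \<open>k/c \<le> m < 2ck\<close>; the upper bound makes
  the powers \<open>2\<^sup>j\<close> add up to \<open>O(k)\<close>, and the lower bound with \<open>c \<le> 2^[c]\<close> gives
  \<open>E\<^sub>m f \<le> E\<^sub>n f\<close> for \<open>n = [k/2^[c]]\<close>.\<close>

section \<open>The Dirichlet kernel\<close>

text \<open>The function \<open>sin (x/2)\<close> is concave on \<open>{0..pi}\<close>, so it lies
  above its chord from \<open>(0, 0)\<close> to \<open>(pi, 1)\<close>.\<close>

lemma sin_half_ge:
  fixes u :: real
  assumes "0 \<le> u" "u \<le> pi"
  shows "u / pi \<le> sin (u / 2)"
proof -
  have "convex_on {0..pi} (\<lambda>x. - sin (x/2))"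
  proof (rule f''_ge0_imp_convex)
    fix x :: real assume "x \<in> {0..pi}"
    show "((\<lambda>x. - sin (x/2)) has_real_derivative - cos (x/2) / 2) (at x)"
      by (auto intro!: derivative_eq_intros)
    show "((\<lambda>x. - cos (x/2) / 2) has_real_derivative sin (x/2) / 4) (at x)"
      by (auto intro!: derivative_eq_intros)
    show "sin (x/2) / 4 \<ge> 0"
      using \<open>x \<in> {0..pi}\<close> by (auto intro!: sin_ge_zero)
  qed simp
  from convex_onD_Icc'[OF this, of u] assms show ?thesis
    by (simp add: field_simps)
qed

text \<open>With the constant term normalised to 1/2, convolution with this kernel yields
  \<open>pi\<close> times the partial sum.\<close>

definition dirichlet_kernel :: "nat \<Rightarrow> real \<Rightarrow> real" where
  "dirichlet_kernel k u = 1 / 2 + (\<Sum>j=1..k. cos (real j * u))"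

lemma dirichlet_kernel_continuous [continuous_intros]:
  fixes f :: "real \<Rightarrow> real"
  shows "continuous_on S f \<Longrightarrow> continuous_on S (\<lambda>x. dirichlet_kernel k (f x))"
  unfolding dirichlet_kernel_def by (intro continuous_intros)

lemma dirichlet_kernel_minus: "dirichlet_kernel k (- u) = dirichlet_kernel k u"
  by (simp add: dirichlet_kernel_def)

lemma dirichlet_kernel_periodic: "dirichlet_kernel k (u + 2 * pi) = dirichlet_kernel k u"
proof -
  have "cos (real j * (u + 2 * pi)) = cos (real j * u)" for j
  proof -
    have "real j * (u + 2 * pi) = real j * u + 2 * real j * pi" by (simp add: algebra_simps)
    then show ?thesis by (simp add: cos_add)
  qed
  then show ?thesis by (simp add: dirichlet_kernel_def)
qed

lemma abs_dirichlet_kernel_le: "\<bar>dirichlet_kernel k u\<bar> \<le> real k + 1"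
proof -
  have "\<bar>dirichlet_kernel k u\<bar> \<le> \<bar>1 / 2\<bar> + \<bar>\<Sum>j=1..k. cos (real j * u)\<bar>"
    unfolding dirichlet_kernel_def by (rule abs_triangle_ineq)
  also have "\<bar>\<Sum>j=1..k. cos (real j * u)\<bar> \<le> (\<Sum>j=1..k. 1)"
    by (rule order.trans[OF sum_abs sum_mono]) simp
  finally show ?thesis by simp
qed

text \<open>The product formula turns each cosine into a difference of neighbouring half-integer
  sines, and the sum telescopes. Sums of kernels thus become sine sums, for which orthogonality is
  available.\<close>

lemma two_sin_times_dirichlet_kernel:
  "2 * sin (u / 2) * dirichlet_kernel k u = sin ((real k + 1 / 2) * u)"
proof (induction k)
  case 0
  then show ?case by (simp add: dirichlet_kernel_def)
next
  case (Suc k)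
  have "dirichlet_kernel (Suc k) u = dirichlet_kernel k u + cos (real (Suc k) * u)"
    by (simp add: dirichlet_kernel_def)
  then have "2 * sin (u / 2) * dirichlet_kernel (Suc k) u =
      sin ((real k + 1 / 2) * u) + 2 * sin (u / 2) * cos (real (Suc k) * u)"
    using Suc by (simp add: algebra_simps)
  also have "2 * sin (u / 2) * cos (real (Suc k) * u) =
      sin (u / 2 + real (Suc k) * u) - sin (real (Suc k) * u - u / 2)"
    by (simp add: sin_add sin_diff)
  also have "u / 2 + real (Suc k) * u = (real (Suc k) + 1 / 2) * u"
    by (simp add: algebra_simps)
  also have "real (Suc k) * u - u / 2 = (real k + 1 / 2) * u"
    by (simp add: field_simps)
  finally show ?case by simp
qed

section \<open>Integrals of trigonometric products and of even periodic functions\<close>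

lemma has_integral_cos_int:
  fixes n :: int
  shows "((\<lambda>t. cos (of_int n * t)) has_integral (if n = 0 then 2 * pi else 0)) {-pi..pi}"
proof (cases "n = 0")
  case True
  then show ?thesis using has_integral_const_real[of "1::real" "-pi" pi] by simp
next
  case False
  have "((\<lambda>t. cos (of_int n * t)) has_integral
      (sin (of_int n * pi) / of_int n - sin (of_int n * (-pi)) / of_int n)) {-pi..pi}"
    using False
    by (intro fundamental_theorem_of_calculus)
      (auto intro!: derivative_eq_intros simp flip: has_real_derivative_iff_has_vector_derivative)
  then show ?thesis using False sin_npi_int[of n] by (simp add: mult.commute)
qed

lemma has_integral_cos_cos:
  "((\<lambda>t. cos (real i * t) * cos (real j * t)) has_integral
    (if i = j then if i = 0 then 2 * pi else pi else 0)) {-pi..pi}"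
proof -
  have "((\<lambda>t. (cos (of_int (int i - int j) * t) + cos (of_int (int i + int j) * t)) / 2) has_integral
     ((if int i - int j = 0 then 2 * pi else 0) + (if int i + int j = 0 then 2 * pi else 0)) / 2) {-pi..pi}"
    by (intro has_integral_divide has_integral_add has_integral_cos_int)
  then show ?thesis
    by (rule has_integral_eq_rhs[OF has_integral_eq, rotated]) (auto simp: cos_times_cos algebra_simps)
qed

lemma has_integral_sin_sin:
  "((\<lambda>t. sin (real i * t) * sin (real j * t)) has_integral
    (if i = j \<and> i \<noteq> 0 then pi else 0)) {-pi..pi}"
proof -
  have "((\<lambda>t. (cos (of_int (int i - int j) * t) - cos (of_int (int i + int j) * t)) / 2) has_integral
     ((if int i - int j = 0 then 2 * pi else 0) - (if int i + int j = 0 then 2 * pi else 0)) / 2) {-pi..pi}"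
    by (intro has_integral_divide has_integral_diff has_integral_cos_int)
  then show ?thesis
    by (rule has_integral_eq_rhs[OF has_integral_eq, rotated]) (auto simp: sin_times_sin algebra_simps)
qed

lemma has_integral_odd:
  fixes f :: "real \<Rightarrow> real"
  assumes "continuous_on {-a..a} f" and odd: "\<And>x. f (- x) = - f x"
  shows "(f has_integral 0) {-a..a}"
proof -
  have "integral {-a..a} (\<lambda>x. f (- x)) = integral {-a..a} f"
    using Henstock_Kurzweil_Integration.integral_reflect_real[of a "-a" f] by simp
  then have "integral {-a..a} f = 0" by (simp add: odd)
  then show ?thesis
    using integrable_integral[OF integrable_continuous_real[OF assms(1)]] by simp
qed

text \<open>The two frequencies differ by \<open>i - j\<close> and add up to
  \<open>i + j + 1\<close>, which is never 0, so no exceptional case arises at index 0.\<close>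

lemma has_integral_sin_half_sin_half:
  "((\<lambda>t. sin ((real i + 1/2) * t) * sin ((real j + 1/2) * t)) has_integral (if i = j then pi else 0)) {-pi..pi}"
proof -
  have "((\<lambda>t. (cos (of_int (int i - int j) * t) - cos (of_int (int i + int j + 1) * t)) / 2) has_integral
     ((if int i - int j = 0 then 2 * pi else 0) - (if int i + int j + 1 = 0 then 2 * pi else 0)) / 2) {-pi..pi}"
    by (intro has_integral_divide has_integral_diff has_integral_cos_int)
  then show ?thesis
    by (rule has_integral_eq_rhs[OF has_integral_eq, rotated]) (auto simp: sin_times_sin algebra_simps)
qed

text \<open>An integral over a full period is invariant under translation, and evenness folds it
  onto \<open>{0..pi}\<close>.\<close>

lemma integral_kernel_translate:
  fixes h :: "real \<Rightarrow> real"
  assumes cont: "continuous_on UNIV h" and even: "\<And>u. h (- u) = h u"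
    and per: "\<And>u. h (u + 2 * pi) = h u" and x: "x \<in> {-pi..pi}"
  shows "integral {-pi..pi} (\<lambda>t. h (x - t)) = 2 * integral {0..pi} h"
proof -
  have int: "h integrable_on {a..b}" for a b
    by (intro integrable_continuous_real continuous_on_subset[OF cont]) simp
  \<comment> \<open>The piece that a right shift pushes beyond \<open>pi\<close> is moved back by
    one period and fills the gap at the left end.\<close>
  have pos: "integral {-pi..pi} (\<lambda>t. h (t + y)) = integral {-pi..pi} h" if "0 \<le> y" "y \<le> pi" for y
  proof -
    have "integral {-pi..pi} (\<lambda>t. h (t + y)) = integral {y-pi..y+pi} h"
      using integral_shift_real_ivl[of "-pi+y" y "pi+y" h] by (simp add: add.commute)
    also have "\<dots> = integral {y-pi..pi} h + integral {pi..y+pi} h"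
      using that Henstock_Kurzweil_Integration.integral_combine[of "y-pi" pi "y+pi" h] int by simp
    also have "integral {pi..y+pi} h = integral {-pi..y-pi} (\<lambda>t. h (t + 2*pi))"
      using integral_shift_real_ivl[of "pi" "2*pi" "pi+y" h] by (simp add: add.commute)
    also have "\<dots> = integral {-pi..y-pi} h" by (simp add: per)
    also have "integral {y-pi..pi} h + integral {-pi..y-pi} h = integral {-pi..pi} h"
      using that Henstock_Kurzweil_Integration.integral_combine[of "-pi" "y-pi" pi h] int by simp
    finally show ?thesis .
  qed
  have "integral {-pi..pi} (\<lambda>t. h (x - t)) = integral {-pi..pi} h"
  proof (cases "x \<ge> 0")
    case True
    have "integral {-pi..pi} (\<lambda>t. h (x - t)) = integral {-pi..pi} (\<lambda>t. h (t + x))"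
      using Henstock_Kurzweil_Integration.integral_reflect_real[of pi "-pi" "\<lambda>t. h (t + x)"] by simp
    then show ?thesis using pos[of x] True x by simp
  next
    case False
    \<comment> \<open>For negative \<open>x\<close>, evenness gives a translation by
      \<open>- x > 0\<close>, so the case above applies.\<close>
    have "h (x - t) = h (t + (- x))" for t using even[of "x - t"] by simp
    then show ?thesis using pos[of "-x"] False x by simp
  qed
  also have "\<dots> = integral {-pi..0} h + integral {0..pi} h"
    using Henstock_Kurzweil_Integration.integral_combine[of "-pi" 0 pi h] int by simp
  also have "integral {-pi..0} h = integral {0..pi} h"
    using Henstock_Kurzweil_Integration.integral_reflect_real[of pi 0 h] by (simp add: even)
  finally show ?thesis by simp
qed

section \<open>The norm of signed sums of Dirichlet kernels\<close>

lemma has_integral_inverse_ln: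
  fixes x y :: real
  assumes "0 < x" "x \<le> y"
  shows "((\<lambda>u. 1/u) has_integral (ln y - ln x)) {x..y}"
proof (rule fundamental_theorem_of_calculus[OF assms(2)])
  fix u assume "u \<in> {x..y}"
  then have "(ln has_real_derivative 1/u) (at u within {x..y})"
    using assms by (auto intro!: derivative_eq_intros)
  then show "(ln has_vector_derivative 1/u) (at u within {x..y})"
    by (simp add: has_real_derivative_iff_has_vector_derivative)
qed

lemma has_integral_inverse_square:
  fixes x y :: real
  assumes "0 < x" "x \<le> y"
  shows "((\<lambda>u. 1/u^2) has_integral (- (1/y) - (- (1/x)))) {x..y}"
proof (rule fundamental_theorem_of_calculus[OF assms(2)])
  fix u assume "u \<in> {x..y}"
  then have "((\<lambda>u. - (1/u)) has_real_derivative 1/u^2) (at u within {x..y})"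
    using assms by (auto intro!: derivative_eq_intros simp: power2_eq_square)
  then show "((\<lambda>u. - (1/u)) has_vector_derivative 1/u^2) (at u within {x..y})"
    by (simp add: has_real_derivative_iff_has_vector_derivative)
qed

text \<open>Half a period suffices because \<open>P\<close> is even. The factors
  \<open>\<epsilon> k\<close> stay free so that duality can later choose them as signs.\<close>

lemma kernel_sum_L1:
  fixes \<epsilon> :: "nat \<Rightarrow> real"
  assumes B: "B \<subseteq> {..<N}" "B \<noteq> {}" and \<epsilon>: "\<And>k. \<bar>\<epsilon> k\<bar> \<le> 1"
  defines "P \<equiv> \<lambda>u. \<Sum>k\<in>B. \<epsilon> k * dirichlet_kernel k u"
  shows "integral {0..pi} (\<lambda>u. \<bar>P u\<bar>) \<le> card B * (6 + 2 * ln (N / card B))"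
proof -
  define b where "b = real (card B)"
  have fin: "finite B" using B finite_subset by blast
  have b1: "1 \<le> b" using B fin by (simp add: b_def Suc_le_eq card_gt_0_iff)
  have bN: "b \<le> real N" using card_mono[OF _ B(1)] by (simp add: b_def)
  have cont: "continuous_on S (\<lambda>u. \<bar>P u\<bar>)" for S
    unfolding P_def by (intro continuous_intros)
  have int: "(\<lambda>u. \<bar>P u\<bar>) integrable_on {x..y}" for x y
    by (intro integrable_continuous_real cont)
  \<comment> \<open>Multiplying \<open>P\<close> by \<open>2 * sin (u / 2)\<close> gives a
    half-integer sine sum, which is bounded by \<open>b\<close> and consists of orthogonal
    terms.\<close>
  define Q where "Q = (\<lambda>u. \<Sum>k\<in>B. \<epsilon> k * sin ((real k + 1/2) * u))"
  have Q_eq: "Q u = 2 * sin (u / 2) * P u" for u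
    unfolding Q_def P_def two_sin_times_dirichlet_kernel[symmetric]
    by (simp add: sum_distrib_left mult_ac)
  have Q_le: "\<bar>Q u\<bar> \<le> b" for u
  proof -
    have "\<bar>Q u\<bar> \<le> (\<Sum>k\<in>B. 1)"
      unfolding Q_def
      by (rule order.trans[OF sum_abs sum_mono]) (simp add: abs_mult \<epsilon> mult_le_one)
    then show ?thesis by (simp add: b_def)
  qed
  have P_le: "\<bar>P u\<bar> \<le> pi * \<bar>Q u\<bar> / (2 * u)" if "0 < u" "u \<le> pi" for u
  proof -
    have "u / pi \<le> sin (u / 2)" using that by (intro sin_half_ge) auto
    then have "2 * (u / pi) * \<bar>P u\<bar> \<le> 2 * sin (u / 2) * \<bar>P u\<bar>"
      by (intro mult_right_mono) auto
    also have "0 \<le> sin (u / 2)" using that by (intro sin_ge_zero) auto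
    then have "2 * sin (u / 2) * \<bar>P u\<bar> = \<bar>Q u\<bar>" by (simp add: Q_eq abs_mult)
    finally show ?thesis using that by (simp add: field_simps)
  qed
  txt \<open>The integral is split at \<open>1/N\<close> and \<open>1/b\<close>: trivial bound \<open>b N\<close> near the origin,
    \<open>2 b / u\<close> in the middle (the source of the logarithm), and orthogonality of the half-integer
    sines, through \<open>2 \<bar>Q u\<bar> / u \<le> (Q u)\<^sup>2 + 1 / u\<^sup>2\<close>, on the rest.\<close>
  have "\<bar>P u\<bar> \<le> b * N" for u
  proof -
    have "\<bar>P u\<bar> \<le> (\<Sum>k\<in>B. real N)"
      unfolding P_def
    proof (rule order.trans[OF sum_abs sum_mono])
      fix k assume "k \<in> B"
      then have "real k + 1 \<le> N" using B by force
      then have "\<bar>dirichlet_kernel k u\<bar> \<le> N" using abs_dirichlet_kernel_le[of k u] by linarith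
      then have "\<bar>\<epsilon> k\<bar> * \<bar>dirichlet_kernel k u\<bar> \<le> 1 * real N"
        by (intro mult_mono \<epsilon>) auto
      then show "\<bar>\<epsilon> k * dirichlet_kernel k u\<bar> \<le> N" by (simp add: abs_mult)
    qed
    then show ?thesis by (simp add: b_def)
  qed
  then have "norm (integral {0..1/N} (\<lambda>u. \<bar>P u\<bar>)) \<le> (b * N) * (1/N - 0)"
    by (intro integral_bound cont) auto
  then have I1: "integral {0..1/N} (\<lambda>u. \<bar>P u\<bar>) \<le> b"
    using b1 bN by auto
  have "((\<lambda>u. b * 2 * (1/u)) has_integral (b * 2 * (ln (1/b) - ln (1/N)))) {1/N..1/b}"
    using b1 bN
    by (intro has_integral_mult_right has_integral_inverse_ln) (auto simp: frac_le)
  moreover have "\<bar>P u\<bar> \<le> b * 2 * (1/u)" if "u \<in> {1/N..1/b}" for u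
  proof -
    have "0 < 1 / real N" "1 / b \<le> 1" using b1 bN by auto
    moreover have "1 / real N \<le> u" "u \<le> 1 / b" using that by auto
    ultimately have u: "0 < u" "u \<le> pi" using pi_ge_two by linarith+
    have "pi * \<bar>Q u\<bar> \<le> 4 * b"
      using pi_less_4 Q_le[of u] by (intro mult_mono) auto
    then show ?thesis using P_le[OF u] u by (simp add: field_simps)
  qed
  ultimately have I2: "integral {1/N..1/b} (\<lambda>u. \<bar>P u\<bar>) \<le> b * 2 * (ln (1/b) - ln (1/N))"
    by (rule has_integral_le[OF integrable_integral[OF int]])
  \<comment> \<open>When the square is expanded, only the diagonal terms survive
    integration.\<close>
  have Q2: "((\<lambda>u. (Q u)^2) has_integral (\<Sum>k\<in>B. pi * (\<epsilon> k)^2)) {-pi..pi}"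
  proof -
    have "((\<lambda>u. \<Sum>k\<in>B. \<Sum>l\<in>B. (\<epsilon> k * \<epsilon> l) * (sin ((real k + 1/2) * u) * sin ((real l + 1/2) * u)))
        has_integral (\<Sum>k\<in>B. \<Sum>l\<in>B. (\<epsilon> k * \<epsilon> l) * (if k = l then pi else 0))) {-pi..pi}"
      by (intro has_integral_sum has_integral_mult_right has_integral_sin_half_sin_half fin)
    moreover have "(\<Sum>k\<in>B. \<Sum>l\<in>B. (\<epsilon> k * \<epsilon> l) * (if k = l then pi else 0)) = (\<Sum>k\<in>B. pi * (\<epsilon> k)^2)"
      by (simp add: fin if_distrib cong: if_cong) (simp add: power2_eq_square mult_ac)
    ultimately show ?thesis
      by (simp add: Q_def power2_eq_square sum_product mult_ac)
  qed
  have Q_int: "(\<lambda>u. (Q u)^2) integrable_on {x..y}" for x y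
    unfolding Q_def by (intro integrable_continuous_real continuous_intros)
  \<comment> \<open>The square is nonnegative, so the range may grow to the full period, where
    orthogonality applies.\<close>
  have "integral {1/b..pi} (\<lambda>u. (Q u)^2) \<le> integral {-pi..pi} (\<lambda>u. (Q u)^2)"
    using b1 by (intro integral_subset_le Q_int) (auto intro: order.trans[of _ 0])
  also have "\<dots> = (\<Sum>k\<in>B. pi * (\<epsilon> k)^2)" using Q2 by (rule integral_unique)
  also have "\<dots> \<le> (\<Sum>k\<in>B. pi * 1)"
    using \<epsilon> by (intro sum_mono mult_left_mono) (auto simp: abs_square_le_1)
  also have "\<dots> = pi * b" by (simp add: b_def)
  also have "\<dots> \<le> 4 * b" using pi_less_4 b1 by (intro mult_right_mono) auto
  finally have Q2': "integral {1/b..pi} (\<lambda>u. (Q u)^2) \<le> 4 * b" .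
  have b_pi: "1/b \<le> pi" "1/b \<le> 1" "0 < 1 / b" using b1 pi_ge_two by (auto intro: order.trans[of _ 1])
  have "((\<lambda>u. 1/u^2) has_integral (- (1/pi) - (- (1/(1/b))))) {1/b..pi}"
    using b_pi by (intro has_integral_inverse_square) auto
  from has_integral_add[OF integrable_integral[OF Q_int[of "1/b" pi]] this]
  have "((\<lambda>u. (Q u)^2 + 1/u^2) has_integral
      (integral {1/b..pi} (\<lambda>u. (Q u)^2) + (- (1/pi) - (- (1/(1/b)))))) {1/b..pi}" .
  moreover have "\<bar>P u\<bar> \<le> (Q u)^2 + 1/u^2" if "u \<in> {1/b..pi}" for u
  proof -
    have "1 / b \<le> u" "u \<le> pi" using that by auto
    then have u: "0 < u" "u \<le> pi" using b_pi(3) by linarith+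
    have "\<bar>P u\<bar> \<le> pi * \<bar>Q u\<bar> / (2 * u)" by (rule P_le[OF u])
    also have "\<dots> \<le> 4 * \<bar>Q u\<bar> / (2 * u)"
      using pi_less_4 u by (intro divide_right_mono mult_right_mono) auto
    also have "\<dots> = 2 * \<bar>Q u\<bar> * (1/u)" by simp
    also have "\<dots> \<le> \<bar>Q u\<bar>^2 + (1/u)^2" by (rule sum_squares_bound)
    finally show ?thesis by (simp add: power_divide)
  qed
  ultimately have "integral {1/b..pi} (\<lambda>u. \<bar>P u\<bar>) \<le>
      integral {1/b..pi} (\<lambda>u. (Q u)^2) + (- (1/pi) - (- (1/(1/b))))"
    by (rule has_integral_le[OF integrable_integral[OF int]])
  moreover have "0 \<le> 1 / pi" "1 / (1 / b) = b" by auto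
  \<comment> \<open>The constant 5 is made of \<open>4 * b\<close> from the square of
    \<open>Q\<close> and \<open>b\<close> from the integral of \<open>1/u^2\<close>.\<close>
  ultimately have I3: "integral {1/b..pi} (\<lambda>u. \<bar>P u\<bar>) \<le> 5 * b"
    using Q2' by linarith
  have "integral {0..pi} (\<lambda>u. \<bar>P u\<bar>) = integral {0..1/N} (\<lambda>u. \<bar>P u\<bar>) +
     (integral {1/N..1/b} (\<lambda>u. \<bar>P u\<bar>) + integral {1/b..pi} (\<lambda>u. \<bar>P u\<bar>))"
  proof -
    have N: "1/real N \<le> 1/b" using b1 bN by (intro divide_left_mono) auto
    show ?thesis
      using Henstock_Kurzweil_Integration.integral_combine[OF _ _ int, of 0 "1/N" pi]
        Henstock_Kurzweil_Integration.integral_combine[OF _ _ int, of "1/N" "1/b" pi] N b_pi b1 bN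
      by simp
  qed
  also have "\<dots> \<le> b + (b * 2 * (ln (1/b) - ln (1/N)) + 5 * b)"
    by (intro add_mono I1 I2 I3)
  also have "\<dots> = b * (6 + 2 * ln (N / b))"
    using b1 bN by (simp add: ln_div algebra_simps)
  finally show ?thesis by (simp add: b_def)
qed

text \<open>The addition formula for \<open>cos (j (x - t))\<close> separates \<open>x\<close> from
  \<open>t\<close>; integrating in \<open>t\<close> then produces the Fourier coefficients.\<close>

lemma fourier_partial_sum_eq_integral:
  assumes "continuous_on {-pi..pi} g"
  shows "((\<lambda>t. g t * dirichlet_kernel k (x - t)) has_integral pi * fourier_partial_sum k g x) {-pi..pi}"
proof -
  have c: "((\<lambda>t. g t * cos (real j * t)) has_integral pi * fourier_cos g j) {-pi..pi}"
    and s: "((\<lambda>t. g t * sin (real j * t)) has_integral pi * fourier_sin g j) {-pi..pi}" for j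
    unfolding fourier_cos_def fourier_sin_def
    by (auto intro!: integrable_integral integrable_continuous_real continuous_intros assms)
  have "((\<lambda>t. g t * cos (real 0 * t) / 2 + (\<Sum>j=1..k. g t * cos (real j * t) * cos (real j * x)
          + g t * sin (real j * t) * sin (real j * x))) has_integral
        pi * fourier_cos g 0 / 2 + (\<Sum>j=1..k. pi * fourier_cos g j * cos (real j * x)
          + pi * fourier_sin g j * sin (real j * x))) {-pi..pi}"
    by (intro has_integral_add has_integral_sum has_integral_mult_left has_integral_divide c s) auto
  moreover have "g t * cos (real 0 * t) / 2 + (\<Sum>j=1..k. g t * cos (real j * t) * cos (real j * x)
          + g t * sin (real j * t) * sin (real j * x)) = g t * dirichlet_kernel k (x - t)" for t
    by (simp add: dirichlet_kernel_def sum_distrib_left right_diff_distrib cos_diff algebra_simps)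
  moreover have "pi * fourier_cos g 0 / 2 + (\<Sum>j=1..k. pi * fourier_cos g j * cos (real j * x)
          + pi * fourier_sin g j * sin (real j * x)) = pi * fourier_partial_sum k g x"
    by (simp add: fourier_partial_sum_def sum_distrib_left algebra_simps)
  ultimately show ?thesis by simp
qed

text \<open>Duality: with \<open>\<epsilon> k\<close> the sign of the \<open>k\<close>-th partial
  sum at \<open>x\<close>, the sum of absolute values is a single integral of \<open>g\<close>
  against a signed kernel sum.\<close>

lemma sum_abs_fourier_partial_sum_le:
  assumes g: "continuous_on {-pi..pi} g" and G: "\<And>t. t \<in> {-pi..pi} \<Longrightarrow> \<bar>g t\<bar> \<le> G"
    and x: "x \<in> {-pi..pi}" and B: "B \<subseteq> {..<N}" "B \<noteq> {}"
  shows "(\<Sum>k\<in>B. \<bar>fourier_partial_sum k g x\<bar>) \<le> G * (card B * (6 + 2 * ln (N / card B)))"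
proof -
  define \<epsilon> where "\<epsilon> = (\<lambda>k. sgn (fourier_partial_sum k g x))"
  define P where "P = (\<lambda>u. \<Sum>k\<in>B. \<epsilon> k * dirichlet_kernel k u)"
  have fin: "finite B" using B finite_subset by blast
  have \<epsilon>: "\<bar>\<epsilon> k\<bar> \<le> 1" for k by (simp add: \<epsilon>_def abs_sgn_eq)
  have G0: "0 \<le> G" using G[OF x] by linarith
  have P: "continuous_on UNIV (\<lambda>u. \<bar>P u\<bar>)" unfolding P_def by (intro continuous_intros)
  have "((\<lambda>t. \<Sum>k\<in>B. \<epsilon> k * (g t * dirichlet_kernel k (x - t))) has_integral
      (\<Sum>k\<in>B. \<epsilon> k * (pi * fourier_partial_sum k g x))) {-pi..pi}"
    by (intro has_integral_sum has_integral_mult_right fourier_partial_sum_eq_integral g fin)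
  moreover have "(\<Sum>k\<in>B. \<epsilon> k * (g t * dirichlet_kernel k (x - t))) = g t * P (x - t)" for t
    by (simp add: P_def sum_distrib_left mult_ac)
  moreover have "(\<Sum>k\<in>B. \<epsilon> k * (pi * fourier_partial_sum k g x)) =
      pi * (\<Sum>k\<in>B. \<bar>fourier_partial_sum k g x\<bar>)"
    by (simp add: \<epsilon>_def sum_distrib_left mult_ac abs_sgn)
  ultimately have I: "((\<lambda>t. g t * P (x - t)) has_integral
      pi * (\<Sum>k\<in>B. \<bar>fourier_partial_sum k g x\<bar>)) {-pi..pi}" by simp
  have "((\<lambda>t. G * \<bar>P (x - t)\<bar>) has_integral G * integral {-pi..pi} (\<lambda>t. \<bar>P (x - t)\<bar>)) {-pi..pi}"
    by (intro has_integral_mult_right integrable_integral integrable_continuous_real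
        continuous_on_compose2[OF P] continuous_intros) auto
  with I have "pi * (\<Sum>k\<in>B. \<bar>fourier_partial_sum k g x\<bar>) \<le> G * integral {-pi..pi} (\<lambda>t. \<bar>P (x - t)\<bar>)"
  proof (rule has_integral_le)
    fix t assume "t \<in> {-pi..pi}"
    then have "\<bar>g t\<bar> * \<bar>P (x - t)\<bar> \<le> G * \<bar>P (x - t)\<bar>" using G by (intro mult_right_mono) auto
    then show "g t * P (x - t) \<le> G * \<bar>P (x - t)\<bar>" by (simp flip: abs_mult)
  qed
  also have "integral {-pi..pi} (\<lambda>t. \<bar>P (x - t)\<bar>) = 2 * integral {0..pi} (\<lambda>u. \<bar>P u\<bar>)"
    using P x by (intro integral_kernel_translate)
      (auto simp: P_def dirichlet_kernel_minus dirichlet_kernel_periodic)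
  also have "G * (2 * integral {0..pi} (\<lambda>u. \<bar>P u\<bar>)) \<le> G * (2 * (card B * (6 + 2 * ln (N / card B))))"
    using G0 kernel_sum_L1[OF B \<epsilon>] by (intro mult_left_mono) (auto simp: P_def)
  finally have *: "pi * (\<Sum>k\<in>B. \<bar>fourier_partial_sum k g x\<bar>) \<le>
      2 * (G * (card B * (6 + 2 * ln (N / card B))))" by (simp add: mult_ac)
  \<comment> \<open>Passing from half a period to a full one costs a factor 2, which the factor
    \<open>pi \<ge> 2\<close> on the left absorbs.\<close>
  have "2 * (\<Sum>k\<in>B. \<bar>fourier_partial_sum k g x\<bar>) \<le> pi * (\<Sum>k\<in>B. \<bar>fourier_partial_sum k g x\<bar>)"
    using pi_ge_two by (intro mult_right_mono sum_nonneg) auto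
  with * show ?thesis by linarith
qed

section \<open>Strong means over blocks of indices\<close>

text \<open>In effect the \<open>r\<close>-th largest value of \<open>v\<close> is at most
  \<open>M * (N / r) powr e\<close>. This controls \<open>p\<close>-th powers also for
  \<open>p > 1\<close>, where the mean over \<open>A\<close> alone would be too weak.\<close>

lemma sum_powr_le_of_subset_sums:
  fixes v :: "'a \<Rightarrow> real" and M N e p :: real
  assumes "finite A" and v: "\<And>k. k \<in> A \<Longrightarrow> 0 \<le> v k" and "0 \<le> M" "0 < N" "0 < p"
    and sub: "\<And>B. B \<subseteq> A \<Longrightarrow> B \<noteq> {} \<Longrightarrow> (\<Sum>k\<in>B. v k) \<le> M * card B * (N / card B) powr e"
  shows "(\<Sum>k\<in>A. v k powr p) \<le> M powr p * (\<Sum>r=1..card A. (N / r) powr (e * p))"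
  using assms(1) v sub
proof (induction "card A" arbitrary: A)
  case 0
  then show ?case by simp
next
  case (Suc n)
  then have "A \<noteq> {}" by auto
  txt \<open>The minimum of \<open>v\<close> is at most its mean over \<open>A\<close>; remove a minimal element and iterate.\<close>
  define a where "a = arg_min_on v A"
  have a: "a \<in> A" and min: "\<And>k. k \<in> A \<Longrightarrow> v a \<le> v k"
    using arg_min_if_finite(1)[OF Suc.prems(1) \<open>A \<noteq> {}\<close>, of v]
      arg_min_least[OF Suc.prems(1) \<open>A \<noteq> {}\<close>, of _ v] by (auto simp: a_def)
  have card: "card (A - {a}) = n" using Suc a by simp
  have "card A * v a \<le> (\<Sum>k\<in>A. v k)" using sum_bounded_below[of A "v a" v] min by simp
  also have "\<dots> \<le> M * card A * (N / card A) powr e" using Suc.prems \<open>A \<noteq> {}\<close> by simp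
  finally have "real (card A) * v a \<le> real (card A) * (M * (N / card A) powr e)"
    by (simp add: mult_ac)
  moreover have "0 < real (card A)" using Suc.hyps(2) by linarith
  ultimately have "v a \<le> M * (N / card A) powr e"
    by (simp only: mult_le_cancel_left_pos)
  then have "v a powr p \<le> (M * (N / card A) powr e) powr p"
    using Suc.prems a \<open>0 < p\<close> by (intro powr_mono2) auto
  also have "\<dots> = M powr p * (N / card A) powr (e * p)"
    using assms by (simp add: powr_mult powr_powr)
  finally have 1: "v a powr p \<le> M powr p * (N / card A) powr (e * p)" .
  have "(\<Sum>k\<in>A - {a}. v k powr p) \<le> M powr p * (\<Sum>r=1..card (A - {a}). (N / r) powr (e * p))"
    using Suc.prems card by (intro Suc.hyps(1)) auto
  with 1 show ?case
    using Suc.prems(1) a card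
    by (simp add: sum.remove[of A a] distrib_left flip: Suc.hyps(2))
qed

text \<open>Each term is at most twice an increment of the square root, and these increments
  telescope.\<close>

lemma sum_inverse_sqrt_le:
  fixes n :: nat
  shows "(\<Sum>r=1..n. 1 / sqrt r) \<le> 2 * sqrt n"
proof (induction n)
  case (Suc n)
  have "1 / sqrt (Suc n) \<le> 2 * (sqrt (Suc n) - sqrt n)"
  proof -
    have "(sqrt (Suc n) - sqrt n) * (sqrt (Suc n) + sqrt n) = 1"
      by (simp add: algebra_simps)
    moreover have "(sqrt (Suc n) - sqrt n) * (sqrt (Suc n) + sqrt n) \<le>
        (sqrt (Suc n) - sqrt n) * (2 * sqrt (Suc n))"
      by (intro mult_left_mono) auto
    ultimately show ?thesis by (simp add: field_simps)
  qed
  with Suc show ?case by simp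
qed simp

text \<open>With the exponent \<open>1 / (2 * p)\<close>, the \<open>p\<close>-th powers of the rank
  bounds become multiples of \<open>sqrt (N / r)\<close>, and these roots sum to at most
  \<open>2 * N\<close>.\<close>

lemma sum_fourier_deviation_powr_le:
  assumes g: "continuous_on {-pi..pi} g" and G: "\<And>t. t \<in> {-pi..pi} \<Longrightarrow> \<bar>g t\<bar> \<le> G"
    and x: "x \<in> {-pi..pi}" and A: "A \<subseteq> {..<N}" and p: "0 < p"
  shows "(\<Sum>k\<in>A. \<bar>fourier_partial_sum k g x - g x\<bar> powr p) \<le> (7 + 4 * p) powr p * (2 * N) * G powr p"
proof (cases "A = {}")
  case False
  then have N: "0 < real N" using A by (cases N) auto
  have fin: "finite A" using A finite_subset by blast
  have G0: "0 \<le> G" using G[OF x] by linarith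
  have "(\<Sum>k\<in>A. \<bar>fourier_partial_sum k g x - g x\<bar> powr p) \<le>
      (G * (7 + 4 * p)) powr p * (\<Sum>r=1..card A. (N / r) powr (1 / (2 * p) * p))"
  proof (rule sum_powr_le_of_subset_sums[OF fin])
    fix B assume B: "B \<subseteq> A" "B \<noteq> {}"
    define b where "b = card B"
    have finB: "finite B" using B fin finite_subset by blast
    have b: "1 \<le> real b" "real b \<le> N"
      using B finB card_mono[of "{..<N}" B] A by (auto simp: b_def Suc_le_eq card_gt_0_iff)
    \<comment> \<open>The logarithm is traded for the power \<open>y\<close> by
      \<open>ln z \<le> z powr e / e\<close>, at the cost \<open>1 / e = 2 * p\<close>. The
      remaining constant 7, which is 6 from the kernel bound plus 1 from the term
      \<open>g x\<close>, is absorbed using \<open>y \<ge> 1\<close>.\<close>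
    define y where "y = (N / b) powr (1 / (2 * p))"
    have "ln (N / b) \<le> y / (1 / (2 * p))"
      unfolding y_def using b p by (intro ln_powr_bound) (auto simp: field_simps)
    then have ln: "ln (N / b) \<le> 2 * p * y" by (simp add: mult_ac)
    have y: "1 \<le> y" unfolding y_def using b p by (intro ge_one_powr_ge_zero) (auto simp: field_simps)
    have "(\<Sum>k\<in>B. \<bar>fourier_partial_sum k g x - g x\<bar>) \<le> (\<Sum>k\<in>B. \<bar>fourier_partial_sum k g x\<bar> + G)"
      using G[OF x] by (intro sum_mono) linarith
    also have "\<dots> \<le> G * (b * (6 + 2 * ln (N / b))) + b * G"
      using sum_abs_fourier_partial_sum_le[OF g G x, of B N] B A by (auto simp: sum.distrib b_def)
    also have "\<dots> = G * b * (7 + 2 * ln (N / b))" by (simp add: algebra_simps)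
    also have "\<dots> \<le> G * b * ((7 + 4 * p) * y)"
      using ln y G0 by (intro mult_left_mono) (auto simp: algebra_simps)
    finally show "(\<Sum>k\<in>B. \<bar>fourier_partial_sum k g x - g x\<bar>) \<le>
        G * (7 + 4 * p) * card B * (N / card B) powr (1 / (2 * p))"
      by (simp add: b_def y_def mult_ac)
  qed (use G0 p N in auto)
  also have "(\<Sum>r=1..card A. (N / r) powr (1 / (2 * p) * p)) = sqrt N * (\<Sum>r=1..card A. 1 / sqrt r)"
    using p by (simp add: powr_half_sqrt real_sqrt_divide sum_distrib_left)
  also have "\<dots> \<le> sqrt N * (2 * sqrt N)"
  proof (intro mult_left_mono)
    have "card A \<le> N" using card_mono[OF _ A] by simp
    then show "(\<Sum>r=1..card A. 1 / sqrt r) \<le> 2 * sqrt N"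
      by (intro order.trans[OF sum_inverse_sqrt_le]) simp
  qed simp
  also have "(G * (7 + 4 * p)) powr p * (sqrt N * (2 * sqrt N)) = (7 + 4 * p) powr p * (2 * N) * G powr p"
    using G0 p by (simp add: powr_mult)
  finally show ?thesis by (simp add: mult_left_mono)
qed simp

section \<open>Best approximation\<close>

lemma abs_le_sup_norm:
  assumes "continuous_on {-pi..pi} g" "t \<in> {-pi..pi}"
  shows "\<bar>g t\<bar> \<le> sup_norm g"
proof -
  have "compact ((\<lambda>t. \<bar>g t\<bar>) ` {-pi..pi})"
    by (intro compact_continuous_image continuous_intros assms) auto
  then have "bdd_above ((\<lambda>t. \<bar>g t\<bar>) ` {-pi..pi})"
    by (intro bounded_imp_bdd_above compact_imp_bounded)
  then show ?thesis unfolding sup_norm_def using assms(2) by (rule cSUP_upper2) simp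
qed

lemma sup_norm_nonneg:
  assumes "continuous_on {-pi..pi} g"
  shows "0 \<le> sup_norm g"
proof -
  have "0 \<le> \<bar>g 0\<bar>" by simp
  also have "\<dots> \<le> sup_norm g" using assms by (rule abs_le_sup_norm) auto
  finally show ?thesis .
qed

lemma continuous_on_trig_poly: "t \<in> trig_polys k \<Longrightarrow> continuous_on S t"
  unfolding trig_polys_def by (auto intro!: continuous_intros)

lemma zero_mem_trig_polys: "(\<lambda>x. 0) \<in> trig_polys k"
  unfolding trig_polys_def by (intro CollectI exI[of _ "\<lambda>_. 0"]) simp

lemma trig_polys_mono:
  assumes "k \<le> l"
  shows "trig_polys k \<subseteq> trig_polys l"
proof
  fix t assume "t \<in> trig_polys k"
  then obtain u v where t: "t = (\<lambda>x. \<Sum>j\<le>k. u j * cos (real j * x) + v j * sin (real j * x))"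
    by (auto simp: trig_polys_def)
  define u' v' where "u' j = (if j \<le> k then u j else 0)" "v' j = (if j \<le> k then v j else 0)" for j
  have "(\<Sum>j\<le>k. u j * cos (real j * x) + v j * sin (real j * x)) =
      (\<Sum>j\<le>l. u' j * cos (real j * x) + v' j * sin (real j * x))" for x
    using assms by (intro sum.mono_neutral_cong_left) (auto simp: u'_v'_def)
  then show "t \<in> trig_polys l" unfolding t trig_polys_def by auto
qed

lemma sup_norm_diff_trig_poly_nonneg:
  assumes "continuous_on {-pi..pi} f" "t \<in> trig_polys k"
  shows "0 \<le> sup_norm (\<lambda>x. f x - t x)"
  by (intro sup_norm_nonneg continuous_intros assms continuous_on_trig_poly[OF assms(2)])

lemma bdd_below_sup_norm_diff:
  assumes "continuous_on {-pi..pi} f"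
  shows "bdd_below ((\<lambda>t. sup_norm (\<lambda>x. f x - t x)) ` trig_polys k)"
  using sup_norm_diff_trig_poly_nonneg[OF assms] by (intro bdd_belowI2[of _ 0])

lemma best_approx_nonneg:
  assumes "continuous_on {-pi..pi} f"
  shows "0 \<le> best_approx k f"
  unfolding best_approx_def
  using zero_mem_trig_polys sup_norm_diff_trig_poly_nonneg[OF assms] by (intro cINF_greatest) auto

lemma best_approx_antimono:
  assumes "continuous_on {-pi..pi} f" "k \<le> l"
  shows "best_approx l f \<le> best_approx k f"
  unfolding best_approx_def
  using zero_mem_trig_polys
  by (intro cINF_superset_mono bdd_below_sup_norm_diff trig_polys_mono assms) auto

lemma best_approx_le_sup_norm:
  assumes "continuous_on {-pi..pi} f"
  shows "best_approx k f \<le> sup_norm f"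
proof -
  have "best_approx k f \<le> sup_norm (\<lambda>x. f x - 0)"
    unfolding best_approx_def
    by (rule cINF_lower[OF bdd_below_sup_norm_diff[OF assms] zero_mem_trig_polys])
  then show ?thesis by simp
qed

section \<open>Reproduction of trigonometric polynomials by partial sums\<close>

lemma has_integral_cos_sin:
  "((\<lambda>t. cos (real i * t) * sin (real j * t)) has_integral 0) {-pi..pi}"
  by (intro has_integral_odd continuous_intros) auto

text \<open>Orthogonality reads off the coefficients of \<open>t\<close>; those beyond
  \<open>m\<close> vanish, so no partial sum of order \<open>k \<ge> m\<close> adds
  anything.\<close>

lemma fourier_partial_sum_trig_poly:
  assumes t: "t \<in> trig_polys m" and "m \<le> k"
  shows "fourier_partial_sum k t x = t x"
proof -
  obtain u v where t_eq: "t = (\<lambda>x. \<Sum>j\<le>m. u j * cos (real j * x) + v j * sin (real j * x))"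
    using t by (auto simp: trig_polys_def)
  \<comment> \<open>The constant mode integrates to \<open>2 * pi\<close> instead of
    \<open>pi\<close>, hence \<open>2 * u 0\<close>; the halving in
    \<open>fourier_partial_sum\<close> undoes this.\<close>
  have c: "fourier_cos t i = (if i \<le> m then if i = 0 then 2 * u 0 else u i else 0)" for i
  proof -
    have "((\<lambda>y. \<Sum>j\<le>m. u j * (cos (real j * y) * cos (real i * y)) + v j * (cos (real i * y) * sin (real j * y)))
      has_integral (\<Sum>j\<le>m. u j * (if j = i then if j = 0 then 2 * pi else pi else 0) + v j * 0)) {-pi..pi}"
      by (intro has_integral_sum has_integral_add has_integral_mult_right has_integral_cos_cos
          has_integral_cos_sin) auto
    moreover have "(\<Sum>j\<le>m. u j * (if j = i then if j = 0 then 2 * pi else pi else 0) + v j * 0) =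
        (\<Sum>j\<le>m. if j = i then u j * (if j = 0 then 2 * pi else pi) else 0)"
      by (intro sum.cong) auto
    moreover have "\<dots> = pi * (if i \<le> m then if i = 0 then 2 * u 0 else u i else 0)"
      by (subst sum.delta) auto
    moreover have "(\<Sum>j\<le>m. u j * (cos (real j * y) * cos (real i * y)) + v j * (cos (real i * y) * sin (real j * y)))
       = t y * cos (real i * y)" for y
      unfolding t_eq sum_distrib_right by (intro sum.cong) (simp_all add: algebra_simps)
    ultimately have "((\<lambda>y. t y * cos (real i * y)) has_integral
        pi * (if i \<le> m then if i = 0 then 2 * u 0 else u i else 0)) {-pi..pi}" by simp
    then show ?thesis unfolding fourier_cos_def by (simp add: integral_unique)
  qed
  \<comment> \<open>At frequency 0 the sine vanishes, so this coefficient is 0 whatever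
    \<open>v 0\<close> is.\<close>
  have s: "fourier_sin t i = (if i \<le> m \<and> i \<noteq> 0 then v i else 0)" for i
  proof -
    have "((\<lambda>y. \<Sum>j\<le>m. u j * (cos (real j * y) * sin (real i * y)) + v j * (sin (real j * y) * sin (real i * y)))
      has_integral (\<Sum>j\<le>m. u j * 0 + v j * (if j = i \<and> j \<noteq> 0 then pi else 0))) {-pi..pi}"
      by (intro has_integral_sum has_integral_add has_integral_mult_right has_integral_sin_sin
          has_integral_cos_sin) auto
    moreover have "(\<Sum>j\<le>m. u j * 0 + v j * (if j = i \<and> j \<noteq> 0 then pi else 0)) =
        (\<Sum>j\<le>m. if j = i then v j * (if j = 0 then 0 else pi) else 0)"
      by (intro sum.cong) auto
    moreover have "\<dots> = pi * (if i \<le> m \<and> i \<noteq> 0 then v i else 0)"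
      by (subst sum.delta) auto
    moreover have "(\<Sum>j\<le>m. u j * (cos (real j * y) * sin (real i * y)) + v j * (sin (real j * y) * sin (real i * y)))
       = t y * sin (real i * y)" for y
      unfolding t_eq sum_distrib_right by (intro sum.cong) (simp_all add: algebra_simps)
    ultimately have "((\<lambda>y. t y * sin (real i * y)) has_integral
        pi * (if i \<le> m \<and> i \<noteq> 0 then v i else 0)) {-pi..pi}" by simp
    then show ?thesis unfolding fourier_sin_def by (simp add: integral_unique)
  qed
  have "fourier_partial_sum k t x =
      u 0 + (\<Sum>j=1..k. fourier_cos t j * cos (real j * x) + fourier_sin t j * sin (real j * x))"
    by (simp add: fourier_partial_sum_def c[of 0])
  also have "(\<Sum>j=1..k. fourier_cos t j * cos (real j * x) + fourier_sin t j * sin (real j * x)) =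
      (\<Sum>j=1..m. u j * cos (real j * x) + v j * sin (real j * x))"
    using \<open>m \<le> k\<close> by (intro sum.mono_neutral_cong_right) (auto simp: c s)
  also have "u 0 + \<dots> = t x"
    by (simp add: t_eq atMost_atLeast0 sum.atLeast_Suc_atMost)
  finally show ?thesis .
qed

lemma fourier_partial_sum_diff:
  assumes "continuous_on {-pi..pi} f" "continuous_on {-pi..pi} g"
  shows "fourier_partial_sum k (\<lambda>x. f x - g x) y = fourier_partial_sum k f y - fourier_partial_sum k g y"
proof -
  have "((\<lambda>t. f t * dirichlet_kernel k (y - t) - g t * dirichlet_kernel k (y - t)) has_integral
      pi * fourier_partial_sum k f y - pi * fourier_partial_sum k g y) {-pi..pi}"
    by (intro has_integral_diff fourier_partial_sum_eq_integral assms)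
  moreover have "((\<lambda>t. (f t - g t) * dirichlet_kernel k (y - t)) has_integral
      pi * fourier_partial_sum k (\<lambda>x. f x - g x) y) {-pi..pi}"
    by (intro fourier_partial_sum_eq_integral continuous_intros assms)
  ultimately have "pi * fourier_partial_sum k (\<lambda>x. f x - g x) y =
      pi * (fourier_partial_sum k f y - fourier_partial_sum k g y)"
    by (simp add: left_diff_distrib right_diff_distrib has_integral_unique)
  then show ?thesis by simp
qed

text \<open>For \<open>k \<ge> m\<close>, subtracting \<open>t \<in> trig_polys m\<close> from
  \<open>f\<close> leaves the deviation unchanged, so the previous bound holds with the norm of
  \<open>f - t\<close> for every such \<open>t\<close>.\<close>

lemma sum_fourier_deviation_powr_le_best_approx:
  assumes f: "continuous_on {-pi..pi} f" and x: "x \<in> {-pi..pi}"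
    and A: "A \<subseteq> {m..<N}" and p: "0 < p"
  shows "(\<Sum>k\<in>A. \<bar>fourier_partial_sum k f x - f x\<bar> powr p) \<le>
    2 * (7 + 4 * p) powr p * N * best_approx m f powr p"
proof (cases "A = {}")
  case False
  define X where "X = (\<Sum>k\<in>A. \<bar>fourier_partial_sum k f x - f x\<bar> powr p)"
  define c where "c = 2 * (7 + 4 * p) powr p * N"
  have "0 < N" using False A by (cases N) auto
  then have c: "0 < c" using p by (simp add: c_def)
  have X: "0 \<le> X" unfolding X_def by (intro sum_nonneg) auto
  \<comment> \<open>The bound is solved for the norm of \<open>f - t\<close>: this gives a lower
    bound independent of \<open>t\<close>, which passes to the infimum without a minimiser, and the
    \<open>p\<close>-th power is restored afterwards.\<close>
  have "(X / c) powr (1 / p) \<le> sup_norm (\<lambda>x. f x - t x)" if t: "t \<in> trig_polys m" for t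
  proof -
    have g: "continuous_on {-pi..pi} (\<lambda>x. f x - t x)"
      by (intro continuous_intros f continuous_on_trig_poly[OF t])
    have eq: "fourier_partial_sum k (\<lambda>x. f x - t x) x - (f x - t x) = fourier_partial_sum k f x - f x"
      if "k \<in> A" for k
      using that A fourier_partial_sum_trig_poly[OF t, of k x]
        fourier_partial_sum_diff[OF f continuous_on_trig_poly[OF t]] by auto
    have "X = (\<Sum>k\<in>A. \<bar>fourier_partial_sum k (\<lambda>x. f x - t x) x - (f x - t x)\<bar> powr p)"
      unfolding X_def by (rule sum.cong[OF refl]) (simp only: eq)
    also have "\<dots> \<le> (7 + 4 * p) powr p * (2 * N) * sup_norm (\<lambda>x. f x - t x) powr p"
      using A by (intro sum_fourier_deviation_powr_le g abs_le_sup_norm x p) auto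
    finally have "X / c \<le> sup_norm (\<lambda>x. f x - t x) powr p"
      using c by (simp add: c_def divide_le_eq mult_ac)
    then have "(X / c) powr (1 / p) \<le> (sup_norm (\<lambda>x. f x - t x) powr p) powr (1 / p)"
      using X c p by (intro powr_mono2) auto
    then show ?thesis using p sup_norm_nonneg[OF g] by (simp add: powr_powr)
  qed
  then have "(X / c) powr (1 / p) \<le> best_approx m f"
    unfolding best_approx_def using zero_mem_trig_polys by (intro cINF_greatest) auto
  then have "((X / c) powr (1 / p)) powr p \<le> best_approx m f powr p"
    using p by (intro powr_mono2) auto
  then have "X / c \<le> best_approx m f powr p" using p X c by (simp add: powr_powr)
  then have "X \<le> c * best_approx m f powr p" using c by (simp add: divide_le_eq mult.commute)
  then show ?thesis unfolding X_def c_def .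
qed simp

section \<open>Dyadic summation against a GM5 sequence\<close>

text \<open>The powers below \<open>y\<close> form a geometric progression, whose sum is less than
  twice its largest term.\<close>

lemma sum_powers_of_two_below:
  fixes y :: real
  assumes "0 \<le> y"
  shows "(\<Sum>j<J. if 2 ^ j < y then 2 ^ j else 0) \<le> 2 * y"
proof (induction J)
  case 0
  then show ?case using assms by simp
next
  case (Suc J)
  show ?case
  proof (cases "2 ^ J < y")
    case True
    have "(\<Sum>j<Suc J. if 2 ^ j < y then 2 ^ j else 0) \<le> (\<Sum>j<Suc J. (2::real) ^ j)"
      by (intro sum_mono) auto
    also have "\<dots> = 2 * 2 ^ J - 1" by (simp add: geometric_sum)
    finally show ?thesis using True by simp
  next
    case False
    then show ?thesis using Suc by simp
  qed
qed

lemma sum_dyadic_blocks: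
  fixes h :: "nat \<Rightarrow> 'a :: comm_monoid_add"
  shows "(\<Sum>k<2 ^ J. h k) = h 0 + (\<Sum>j<J. \<Sum>k=2^j..<2*2^j. h k)"
proof (induction J)
  case (Suc J)
  have "(\<Sum>k<2 ^ Suc J. h k) = (\<Sum>k<2 ^ J. h k) + (\<Sum>k=2^J..<2*2^J. h k)"
    by (simp add: lessThan_atLeast0 sum.atLeastLessThan_concat)
  with Suc show ?case by (simp add: add.assoc)
qed simp

lemma diff_le_total_variation:
  fixes a :: "nat \<Rightarrow> real"
  assumes "k \<in> {m..n}" "l \<in> {m..n}"
  shows "a k - a l \<le> (\<Sum>i=m..<n. \<bar>a i - a (i+1)\<bar>)"
proof -
  have "\<bar>a i - a j\<bar> \<le> (\<Sum>i=m..<n. \<bar>a i - a (i+1)\<bar>)" if "m \<le> i" "i \<le> j" "j \<le> n" for i j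
  proof -
    have "\<bar>a i - a j\<bar> = \<bar>\<Sum>r=i..<j. a (r+1) - a r\<bar>"
      using sum_Suc_diff'[OF that(2), of a] by (simp add: abs_minus_commute)
    also have "\<dots> \<le> (\<Sum>r=i..<j. \<bar>a (r+1) - a r\<bar>)" by (rule sum_abs)
    also have "\<dots> \<le> (\<Sum>r=m..<n. \<bar>a (r+1) - a r\<bar>)" using that by (intro sum_mono2) auto
    finally show ?thesis by (simp add: abs_minus_commute)
  qed
  from this[of k l] this[of l k] assms show ?thesis by (cases "k \<le> l") auto
qed

text \<open>The inequality \<open>a k \<le> a l + V\<close> is summed over the \<open>m\<close>
  indices \<open>l\<close> of the block, and GM5 bounds \<open>V\<close>.\<close>

lemma GM5_block_le:
  fixes a :: "nat \<Rightarrow> real"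
  assumes a: "\<And>k. 0 \<le> a k" and GM: "GM5 c K a" and m: "1 \<le> m" and k: "k \<in> {m..<2*m}"
  shows "real m * a k \<le> (\<Sum>l=m..<2*m. a l) +
    K * (\<Sum>l=max 1 (nat \<lfloor>real m / c\<rfloor>)..nat \<lfloor>c * real m\<rfloor>. real m * (a l / real l))"
proof -
  define V where "V = (\<Sum>i=m..2*m-1. \<bar>a i - a (i+1)\<bar>)"
  have "a k \<le> a l + V" if "l \<in> {m..<2*m}" for l
  proof -
    have "a k - a l \<le> (\<Sum>i=m..<2*m. \<bar>a i - a (i+1)\<bar>)"
      using k that by (intro diff_le_total_variation) auto
    \<comment> \<open>The increments between \<open>m\<close> and \<open>2 * m\<close> are exactly
      those in the GM5 sum, the last one reaching \<open>a (2 * m)\<close>.\<close>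
    also have "{m..<2*m} = {m..2*m-1}" using m by auto
    finally show ?thesis unfolding V_def by simp
  qed
  then have "(\<Sum>l=m..<2*m. a k) \<le> (\<Sum>l=m..<2*m. a l + V)" by (intro sum_mono)
  then have "real m * a k \<le> (\<Sum>l=m..<2*m. a l) + real m * V" by (simp add: sum.distrib)
  also have "real m * V \<le> real m * (K * (\<Sum>l=max 1 (nat \<lfloor>real m / c\<rfloor>)..nat \<lfloor>c * real m\<rfloor>. a l / real l))"
    using GM m unfolding GM5_def V_def by (intro mult_left_mono) auto
  also have "\<dots> = K * (\<Sum>l=max 1 (nat \<lfloor>real m / c\<rfloor>)..nat \<lfloor>c * real m\<rfloor>. real m * (a l / real l))"
    by (simp add: sum_distrib_left mult_ac)
  finally show ?thesis by simp
qed

text \<open>The dilation \<open>2 ^ nat \<lfloor>c\<rfloor>\<close> is at least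
  \<open>nat \<lfloor>c\<rfloor> + 1\<close>, which exceeds \<open>c\<close>.\<close>

lemma floor_div_le_of_le:
  fixes y :: real
  assumes "1 < c" "y \<le> c * real m"
  shows "nat \<lfloor>y / 2 ^ nat \<lfloor>c\<rfloor>\<rfloor> \<le> m"
proof -
  have "c < real (nat \<lfloor>c\<rfloor>) + 1" using assms by linarith
  also have "\<dots> \<le> 2 ^ nat \<lfloor>c\<rfloor>"
    using Suc_leI[OF less_exp[of "nat \<lfloor>c\<rfloor>"]] by (metis of_nat_Suc of_nat_le_iff of_nat_numeral of_nat_power add.commute)
  finally have "y \<le> 2 ^ nat \<lfloor>c\<rfloor> * real m"
    using assms(2) by (meson less_imp_le mult_right_mono of_nat_0_le_iff order.trans)
  then have "y / 2 ^ nat \<lfloor>c\<rfloor> \<le> real m" by (simp add: divide_le_eq mult.commute)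
  then show ?thesis by (simp add: nat_le_iff floor_le_iff)
qed

text \<open>In the application \<open>\<sigma> k\<close> is the \<open>p\<close>-th power of a
  deviation and \<open>w k\<close> that of \<open>best_approx k f\<close>. In the constant, 1 comes
  from index 0, 2 from the block means and \<open>8 * c * K\<close> from the variation.\<close>

lemma GM5_weighted_sum_le:
  fixes a \<sigma> w :: "nat \<Rightarrow> real"
  assumes a: "\<And>k. 0 \<le> a k" and \<sigma>: "\<And>k. 0 \<le> \<sigma> k" and w: "\<And>k. 0 \<le> w k"
    and anti: "\<And>k l. k \<le> l \<Longrightarrow> w l \<le> w k"
    and D: "0 \<le> D" and block: "\<And>m N A. A \<subseteq> {m..<N} \<Longrightarrow> (\<Sum>k\<in>A. \<sigma> k) \<le> D * real N * w m"
    and c: "1 < c" and K: "0 \<le> K" and GM: "GM5 c K a"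
  defines "w' \<equiv> \<lambda>k. w (nat \<lfloor>real k / 2 ^ nat \<lfloor>c\<rfloor>\<rfloor>)"
  assumes summable: "summable (\<lambda>k. a k * w' k)"
  shows "(\<Sum>k<n. a k * \<sigma> k) \<le> D * (3 + 8 * c * K) * (\<Sum>k. a k * w' k)"
proof -
  define S where "S = (\<Sum>k. a k * w' k)"
  have w': "0 \<le> w' k" for k by (simp add: w'_def w)
  have le_S: "(\<Sum>k\<in>A. a k * w' k) \<le> S" if "finite A" for A
    unfolding S_def using that by (intro sum_le_suminf summable) (auto simp: a w')
  have w_le: "w m \<le> w' k" if "real k \<le> c * real m" for k m
    unfolding w'_def using that c by (intro anti floor_div_le_of_le) auto
  define R where "R m = {max 1 (nat \<lfloor>real m / c\<rfloor>)..nat \<lfloor>c * real m\<rfloor>}" for m :: nat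
  have R_le: "real k \<le> c * real m" "real m < 2 * c * real k" "1 \<le> k" if "k \<in> R m" for k m
  proof -
    show "real k \<le> c * real m" using that c unfolding R_def by (auto simp: le_nat_floor le_nat_iff le_floor_iff)
    show k1: "1 \<le> k" using that by (auto simp: R_def)
    have "nat \<lfloor>real m / c\<rfloor> \<le> k" using that by (auto simp: R_def)
    \<comment> \<open>Rounding down loses less than 1, and the lower end \<open>max 1\<close> of
      \<open>R m\<close> turns \<open>k + 1\<close> into at most \<open>2 * k\<close>.\<close>
    then have "real m / c < real k + 1" by linarith
    also have "\<dots> \<le> 2 * real k" using k1 by simp
    finally show "real m < 2 * c * real k" using c by (simp add: field_simps)
  qed
  have block_le: "(\<Sum>k=m..<2*m. a k * \<sigma> k) \<le>
      2 * D * ((\<Sum>k=m..<2*m. a k * w' k) + K * (\<Sum>k\<in>R m. real m * (a k * w' k / real k)))"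
    if m: "1 \<le> m" for m :: nat
  proof -
    define T where "T = (\<Sum>l=m..<2*m. a l) + K * (\<Sum>l\<in>R m. real m * (a l / real l))"
    have T: "0 \<le> T" unfolding T_def by (intro add_nonneg_nonneg mult_nonneg_nonneg sum_nonneg K) (auto simp: a)
    have "a k \<le> T / m" if "k \<in> {m..<2*m}" for k
      using GM5_block_le[OF a GM m that] m by (simp add: T_def R_def field_simps)
    then have "(\<Sum>k=m..<2*m. a k * \<sigma> k) \<le> (\<Sum>k=m..<2*m. T / m * \<sigma> k)"
      by (intro sum_mono mult_right_mono \<sigma>)
    \<comment> \<open>The block ends at \<open>2 * m\<close>; after cancelling \<open>m\<close> this
      leaves the factor 2.\<close>
    also have "\<dots> \<le> T / m * (D * real (2*m) * w m)"
      unfolding sum_distrib_left[symmetric] using T by (intro mult_left_mono block) auto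
    also have "\<dots> = 2 * D * (T * w m)" using m by simp
    also have "T * w m = (\<Sum>l=m..<2*m. a l * w m) + K * (\<Sum>l\<in>R m. real m * (a l * w m / real l))"
      by (simp add: T_def sum_distrib_left sum_distrib_right algebra_simps)
    also have "2 * D * \<dots> \<le> 2 * D * ((\<Sum>k=m..<2*m. a k * w' k) + K * (\<Sum>k\<in>R m. real m * (a k * w' k / real k)))"
    proof (intro mult_left_mono add_mono sum_mono divide_right_mono a K)
      fix k assume "k \<in> {m..<2*m}"
      show "w m \<le> w' k"
      proof -
        \<comment> \<open>Inside the block \<open>k < 2 * m\<close>, so a dilation by at least 2 is
          enough, and \<open>c > 1\<close> provides it.\<close>
        have "2 ^ 1 \<le> (2::nat) ^ nat \<lfloor>c\<rfloor>" using c by (intro power_increasing) (auto simp: le_nat_iff le_floor_iff)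
        then have "2 \<le> (2::real) ^ nat \<lfloor>c\<rfloor>" by (metis of_nat_le_iff of_nat_numeral of_nat_power power_one_right)
        then have "real k / 2 ^ nat \<lfloor>c\<rfloor> \<le> real k / 2" by (intro divide_left_mono) auto
        also have "\<dots> \<le> real m" using \<open>k \<in> {m..<2*m}\<close> by simp
        finally have "nat \<lfloor>real k / 2 ^ nat \<lfloor>c\<rfloor>\<rfloor> \<le> m" by (simp add: nat_le_iff floor_le_iff)
        then show ?thesis unfolding w'_def by (rule anti)
      qed
    next
      fix k assume "k \<in> R m"
      then show "w m \<le> w' k" by (intro w_le R_le)
    qed (use D in auto)
    finally show ?thesis .
  qed
  obtain J where "n \<le> 2 ^ J" using less_exp[of n] less_imp_le by blast
  then have "(\<Sum>k<n. a k * \<sigma> k) \<le> (\<Sum>k<2^J. a k * \<sigma> k)"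
    using a \<sigma> by (intro sum_mono2) auto
  also have "\<dots> = a 0 * \<sigma> 0 + (\<Sum>j<J. \<Sum>k=2^j..<2*2^j. a k * \<sigma> k)" by (rule sum_dyadic_blocks)
  also have "\<dots> \<le> D * S + (\<Sum>j<J. 2 * D * ((\<Sum>k=2^j..<2*2^j. a k * w' k) +
      K * (\<Sum>k\<in>R (2^j). 2^j * (a k * w' k / real k))))"
  proof (intro add_mono sum_mono)
    \<comment> \<open>Index 0 lies in no dyadic block; the hypothesis on blocks with
      \<open>m = 0\<close> and \<open>N = 1\<close> covers it.\<close>
    have "\<sigma> 0 \<le> D * w' 0" using block[of "{0}" 0 1] by (simp add: w'_def)
    from mult_left_mono[OF this a[of 0]] have "a 0 * \<sigma> 0 \<le> D * (a 0 * w' 0)" by (simp add: mult_ac)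
    also have "\<dots> \<le> D * S" using le_S[of "{0}"] D by (intro mult_left_mono) auto
    finally show "a 0 * \<sigma> 0 \<le> D * S" .
    fix j
    show "(\<Sum>k=2^j..<2*2^j. a k * \<sigma> k) \<le> 2 * D * ((\<Sum>k=2^j..<2*2^j. a k * w' k) +
      K * (\<Sum>k\<in>R (2^j). 2^j * (a k * w' k / real k)))"
      using block_le[of "2^j"] by simp
  qed
  also have "\<dots> = D * S + 2 * D * ((\<Sum>j<J. \<Sum>k=2^j..<2*2^j. a k * w' k) +
      K * (\<Sum>j<J. \<Sum>k\<in>R (2^j). 2^j * (a k * w' k / real k)))"
    by (simp add: sum_distrib_left sum.distrib distrib_left)
  also have "\<dots> \<le> D * S + 2 * D * (S + K * (4 * c * S))"
  proof (intro add_left_mono mult_left_mono add_mono K)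
    have "(\<Sum>j<J. \<Sum>k=2^j..<2*2^j. a k * w' k) = (\<Sum>k<2^J. a k * w' k) - a 0 * w' 0"
      by (simp add: sum_dyadic_blocks)
    also have "\<dots> \<le> S" using le_S[of "{..<2^J}"] mult_nonneg_nonneg[OF a[of 0] w'[of 0]] by simp
    finally show "(\<Sum>j<J. \<Sum>k=2^j..<2*2^j. a k * w' k) \<le> S" .
    \<comment> \<open>A common index set for all blocks allows the sums to be interchanged; of
      membership in \<open>R (2^j)\<close> only \<open>2^j < 2 * c * real k\<close> is kept.\<close>
    define M where "M = (\<Union>j<J. R (2^j))"
    have fin: "finite M" by (auto simp: M_def R_def)
    have "(\<Sum>j<J. \<Sum>k\<in>R (2^j). 2^j * (a k * w' k / real k)) \<le>
       (\<Sum>j<J. \<Sum>k\<in>M. (if 2^j < 2 * c * real k then 2^j else 0) * (a k * w' k / real k))"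
    proof (intro sum_mono)
      fix j assume "j \<in> {..<J}"
      have "(\<Sum>k\<in>R (2^j). 2^j * (a k * w' k / real k)) =
        (\<Sum>k\<in>R (2^j). (if 2^j < 2 * c * real k then 2^j else 0) * (a k * w' k / real k))"
        using R_le(2)[of _ "2^j"] by (intro sum.cong) auto
      also have "\<dots> \<le> (\<Sum>k\<in>M. (if 2^j < 2 * c * real k then 2^j else 0) * (a k * w' k / real k))"
        using fin \<open>j \<in> {..<J}\<close> by (intro sum_mono2) (auto simp: M_def a w')
      finally show "(\<Sum>k\<in>R (2^j). 2^j * (a k * w' k / real k)) \<le>
        (\<Sum>k\<in>M. (if 2^j < 2 * c * real k then 2^j else 0) * (a k * w' k / real k))" .
    qed
    also have "\<dots> = (\<Sum>k\<in>M. (\<Sum>j<J. if 2^j < 2 * c * real k then 2^j else 0) * (a k * w' k / real k))"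
      unfolding sum_distrib_right by (rule sum.swap)
    \<comment> \<open>For fixed \<open>k\<close> the powers of two add up to at most
      \<open>4 * c * k\<close>, and the division by \<open>k\<close> cancels this growth.\<close>
    also have "\<dots> \<le> (\<Sum>k\<in>M. (2 * (2 * c * real k)) * (a k * w' k / real k))"
      using c by (intro sum_mono mult_right_mono sum_powers_of_two_below) (auto simp: a w')
    also have "\<dots> = (\<Sum>k\<in>M. 4 * c * (a k * w' k))"
      using R_le(3) by (intro sum.cong) (auto simp: M_def Suc_le_eq)
    also have "\<dots> \<le> 4 * c * S"
      unfolding sum_distrib_left[symmetric] using le_S[OF fin] c by (intro mult_left_mono) auto
    finally show "(\<Sum>j<J. \<Sum>k\<in>R (2^j). 2^j * (a k * w' k / real k)) \<le> 4 * c * S" .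
  qed (use D in auto)
  also have "\<dots> = D * (3 + 8 * c * K) * S" by (simp add: algebra_simps)
  finally show ?thesis by (simp add: S_def)
qed

section \<open>The estimate for the strong means\<close>

theorem theorem4:
  fixes p c K :: real
  assumes "p > 0" and "c > 1" and "K > 0"
  shows "\<exists>C>0. \<forall>a :: nat \<Rightarrow> nat \<Rightarrow> real.
           (\<forall>n k. a n k \<ge> 0) \<longrightarrow>
           (\<forall>n. (\<lambda>k. a n k) sums 1) \<longrightarrow>
           (\<lambda>n. a n 0) \<longlonglongrightarrow> 0 \<longrightarrow>
           (\<forall>n. GM5 c K (a n)) \<longrightarrow>
           (\<forall>f\<in>C2pi. \<forall>n.
              ennreal_sup_norm (strong_mean (a n) p f)
              \<le> ennreal (C * (\<Sum>k. a n k * best_approx (nat \<lfloor>real k / 2 ^ nat \<lfloor>c\<rfloor>\<rfloor>) f powr p)))"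
proof (intro exI[of _ "2 * (7 + 4 * p) powr p * (3 + 8 * c * K)"] conjI allI impI ballI)
  \<comment> \<open>The factor \<open>2 * (7 + 4 * p) powr p\<close> of the witness comes from sums
    of deviations over blocks, and \<open>3 + 8 * c * K\<close> from the dyadic summation.\<close>
  show "0 < 2 * (7 + 4 * p) powr p * (3 + 8 * c * K)"
    using assms by (intro mult_pos_pos add_pos_pos) auto
next
  fix a :: "nat \<Rightarrow> nat \<Rightarrow> real" and f n
  assume a: "\<forall>n k. a n k \<ge> 0" "\<forall>n. (\<lambda>k. a n k) sums 1" and GM: "\<forall>n. GM5 c K (a n)"
    and "f \<in> C2pi"
  then have f: "continuous_on {-pi..pi} f" by (auto simp: C2pi_def intro: continuous_on_subset)
  define w where "w k = best_approx k f powr p" for k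
  \<comment> \<open>The real series on the right must converge for its \<open>suminf\<close> to be
    meaningful; it is dominated by a row of sum 1 times \<open>sup_norm f powr p\<close>.\<close>
  have summable: "summable (\<lambda>k. a n k * w (nat \<lfloor>real k / 2 ^ nat \<lfloor>c\<rfloor>\<rfloor>))"
  proof (rule summable_comparison_test')
    show "summable (\<lambda>k. a n k * sup_norm f powr p)"
      using a(2) by (intro summable_mult2) (auto dest: sums_summable)
    have "w k \<le> sup_norm f powr p" for k
      unfolding w_def using assms
      by (intro powr_mono2 best_approx_nonneg best_approx_le_sup_norm f) auto
    then show "norm (a n k * w (nat \<lfloor>real k / 2 ^ nat \<lfloor>c\<rfloor>\<rfloor>)) \<le> a n k * sup_norm f powr p" for k
      using a(1) by (auto simp: abs_mult w_def intro!: mult_left_mono)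
  qed
  have sum_le: "(\<Sum>k<i. a n k * \<bar>fourier_partial_sum k f x - f x\<bar> powr p) \<le>
      2 * (7 + 4 * p) powr p * (3 + 8 * c * K) * (\<Sum>k. a n k * w (nat \<lfloor>real k / 2 ^ nat \<lfloor>c\<rfloor>\<rfloor>))"
    if "x \<in> {-pi..pi}" for x i
  proof (rule GM5_weighted_sum_le)
    show "(\<Sum>k\<in>A. \<bar>fourier_partial_sum k f x - f x\<bar> powr p) \<le> 2 * (7 + 4 * p) powr p * real N * w m"
      if "A \<subseteq> {m..<N}" for A m N
      unfolding w_def using f \<open>x \<in> {-pi..pi}\<close> that assms(1)
      by (rule sum_fourier_deviation_powr_le_best_approx)
    show "w l \<le> w k" if "k \<le> l" for k l
      unfolding w_def using assms f that
      by (intro powr_mono2 best_approx_nonneg best_approx_antimono) auto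
  qed (use assms a GM summable in \<open>auto simp: w_def\<close>)
  have "strong_mean (a n) p f x \<le> ennreal (2 * (7 + 4 * p) powr p * (3 + 8 * c * K) *
      (\<Sum>k. a n k * w (nat \<lfloor>real k / 2 ^ nat \<lfloor>c\<rfloor>\<rfloor>)))" if "x \<in> {-pi..pi}" for x
    unfolding strong_mean_def
  \<comment> \<open>In \<open>ennreal\<close> every series converges, so the uniform bound on
    partial sums suffices.\<close>
  proof (rule suminf_le_const[OF summableI])
    fix i
    show "(\<Sum>k<i. ennreal (a n k * \<bar>fourier_partial_sum k f x - f x\<bar> powr p)) \<le>
      ennreal (2 * (7 + 4 * p) powr p * (3 + 8 * c * K) *
        (\<Sum>k. a n k * w (nat \<lfloor>real k / 2 ^ nat \<lfloor>c\<rfloor>\<rfloor>)))"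
      using sum_le[OF that] a(1) by (subst sum_ennreal) (auto intro!: ennreal_leI)
  qed
  then show "ennreal_sup_norm (strong_mean (a n) p f) \<le> ennreal (2 * (7 + 4 * p) powr p * (3 + 8 * c * K) *
      (\<Sum>k. a n k * best_approx (nat \<lfloor>real k / 2 ^ nat \<lfloor>c\<rfloor>\<rfloor>) f powr p))"
    unfolding ennreal_sup_norm_def w_def by (intro SUP_least)
qed

end
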